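(* Let $\mathcal{A}$ be a simplicial real central hyperplane arrangement with fundamental chamber $c_0$. A subset $I\subseteq\mathcal{A}$ is biclosed if and only if $I=S(c)$ for some chamber $c$.
   Context: $\mathcal{A}$ is a finite set of linear hyperplanes in $\mathbb{R}^n$; chambers are the connected components of the complement of their union. $\mathcal{A}$ is simplicial if every chamber is a simplicial cone, i.e. the normal vectors of its walls (hyperplanes $H$ with $\dim(\overline{c}\cap H)=n-1$) are linearly independent. $S(c)$ is the set of hyperplanes separating $c_0$ from $c$. $I$ is convex (w.r.t. $c_0$) if for each $H\in\mathcal{A}\setminus I$ there is a chamber $c$ with $H\in S(c)\subseteq\mathcal{A}\setminus I$; $I$ is 2-closed if for every codimension 2 intersection subspace $X$, $I\cap\mathcal{A}_X$ is convex in $\mathcal{A}_X=\{H:H\supseteq X\}$ with fundamental chamber the chamber of $\mathcal{A}_X$ containing $c_0$; $I$ is biclosed if $I$ and $\mathcal{A}\setminus I$ are both 2-closed. *)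

theory Defs
  imports "HOL-Analysis.Analysis"
begin

definition linear_hyperplane :: "'a::euclidean_space set \<Rightarrow> bool" where
  "linear_hyperplane H \<longleftrightarrow> (\<exists>a. a \<noteq> 0 \<and> H = {x. a \<bullet> x = 0})"

definition central_arrangement :: "'a::euclidean_space set set \<Rightarrow> bool" where
  "central_arrangement A \<longleftrightarrow> finite A \<and> (\<forall>H\<in>A. linear_hyperplane H)"

definition chambers :: "'a::euclidean_space set set \<Rightarrow> 'a set set" where
  "chambers A = components (- \<Union>A)"

text \<open>For a chamber \<open>c\<close> the set \<open>closure c \<inter> H\<close> contains the origin, so
  the linear dimension \<^const>\<open>dim\<close> agrees with its dimension as a convex cone.\<close>

definition walls :: "'a::euclidean_space set set \<Rightarrow> 'a set \<Rightarrow> 'a set set" where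
  "walls A c = {H \<in> A. dim (closure c \<inter> H) = DIM('a) - 1}"

text \<open>A normal vector is determined up to a nonzero scalar, which affects neither
  linear independence of normals of distinct hyperplanes nor injectivity of the choice.\<close>

definition normal_vector :: "'a::euclidean_space set \<Rightarrow> 'a" where
  "normal_vector H = (SOME a. a \<noteq> 0 \<and> H = {x. a \<bullet> x = 0})"

definition simplicial_arrangement :: "'a::euclidean_space set set \<Rightarrow> bool" where
  "simplicial_arrangement A \<longleftrightarrow>
     (\<forall>c\<in>chambers A. independent (normal_vector ` walls A c))"

definition separates :: "'a::euclidean_space set \<Rightarrow> 'a set \<Rightarrow> 'a set \<Rightarrow> bool" where
  "separates H c d \<longleftrightarrow>
     (\<exists>a. a \<noteq> 0 \<and> H = {x. a \<bullet> x = 0} \<and> c \<subseteq> {x. a \<bullet> x < 0} \<and> d \<subseteq> {x. a \<bullet> x > 0})"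

definition separating_set ::
    "'a::euclidean_space set set \<Rightarrow> 'a set \<Rightarrow> 'a set \<Rightarrow> 'a set set" where
  "separating_set A c0 c = {H \<in> A. separates H c0 c}"

definition convex_subset ::
    "'a::euclidean_space set set \<Rightarrow> 'a set \<Rightarrow> 'a set set \<Rightarrow> bool" where
  "convex_subset A c0 I \<longleftrightarrow>
     (\<forall>H \<in> A - I. \<exists>c\<in>chambers A. H \<in> separating_set A c0 c \<and> separating_set A c0 c \<subseteq> A - I)"

definition intersection_subspaces :: "'a::euclidean_space set set \<Rightarrow> 'a set set" where
  "intersection_subspaces A = {\<Inter>B | B. B \<subseteq> A}"

definition localization :: "'a::euclidean_space set set \<Rightarrow> 'a set \<Rightarrow> 'a set set" where
  "localization A X = {H \<in> A. X \<subseteq> H}"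

definition chamber_containing :: "'a::euclidean_space set set \<Rightarrow> 'a set \<Rightarrow> 'a set" where
  "chamber_containing A c = (THE d. d \<in> chambers A \<and> c \<subseteq> d)"

lemma ex1_chamber_containing:
  assumes "c \<in> chambers A" and "B \<subseteq> A"
  shows "\<exists>!d. d \<in> chambers B \<and> c \<subseteq> d"
proof -
  have c: "connected c" "c \<noteq> {}" "c \<subseteq> - \<Union>A"
    using assms(1) in_components_connected in_components_nonempty in_components_subset
    unfolding chambers_def by blast+
  then have "c \<subseteq> - \<Union>B" "- \<Union>B \<noteq> {}"
    using assms(2) by blast+
  then obtain d where "d \<in> components (- \<Union>B)" "c \<subseteq> d"
    using exists_component_superset c(1) by metis
  moreover have "d = e"
    if "d \<in> components (- \<Union>B)" "c \<subseteq> d" "e \<in> components (- \<Union>B)" "c \<subseteq> e" for d e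
    using that c(2) components_nonoverlap by (metis Int_greatest subset_empty)
  ultimately show ?thesis
    unfolding chambers_def by blast
qed

text \<open>Codimension 2 is expressed additively, since \<open>DIM('a) - 2\<close> would truncate
  for \<open>DIM('a) = 1\<close>.\<close>

definition two_closed ::
    "'a::euclidean_space set set \<Rightarrow> 'a set \<Rightarrow> 'a set set \<Rightarrow> bool" where
  "two_closed A c0 I \<longleftrightarrow>
     (\<forall>X\<in>intersection_subspaces A. dim X + 2 = DIM('a) \<longrightarrow>
        convex_subset (localization A X) (chamber_containing (localization A X) c0)
          (I \<inter> localization A X))"

definition biclosed ::
    "'a::euclidean_space set set \<Rightarrow> 'a set \<Rightarrow> 'a set set \<Rightarrow> bool" where
  "biclosed A c0 I \<longleftrightarrow> two_closed A c0 I \<and> two_closed A c0 (A - I)"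

end

theory Submission
  imports Defs
begin

text \<open>Chambers are handled as sign cells of generic points \<open>x\<close>, so that separation becomes a
  pointwise comparison of signs.  For every chamber \<open>c\<close> the set \<open>S(c)\<close> is the complement of
  \<open>S(-c)\<close>, hence biclosed.  Conversely, in rank two, among any three sets \<open>S(d)\<close> two
  are nested, so a biclosed \<open>I\<close> restricts to some \<open>S(e)\<close> on each
  \<open>A\<^sub>X\<close>.  Choose \<open>x\<close> minimising the cardinality of the symmetric difference \<open>J\<close> of
  \<open>S(x)\<close> and \<open>I\<close>; if \<open>J \<noteq> {}\<close>, choose \<open>y\<close> closest to \<open>x\<close> such that some
  hyperplane of \<open>J\<close> separates them.  Walking from \<open>y\<close> to \<open>x\<close>, the first two walls crossed are
  \<open>H \<in> J\<close> and \<open>H' \<notin> J\<close>.  Both are walls of the chamber in between, so by simpliciality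
  they meet in a codimension two face of it, with span \<open>X\<close>.  Among the chambers at this face,
  the one that differs in \<open>A\<^sub>X\<close> from \<open>x\<close> only by the first wall on the way to \<open>e\<close> is
  closer to \<open>x\<close> than \<open>y\<close>, and that wall is in \<open>J\<close>: a contradiction.\<close>

section \<open>Signs of points relative to an arrangement\<close>

definition generic :: "'a::euclidean_space set set \<Rightarrow> 'a \<Rightarrow> bool" where
  "generic B x \<longleftrightarrow> (\<forall>H\<in>B. normal_vector H \<bullet> x \<noteq> 0)"

definition cell :: "'a::euclidean_space set set \<Rightarrow> 'a \<Rightarrow> 'a set" where
  "cell B x = {y. \<forall>H\<in>B. sgn (normal_vector H \<bullet> y) = sgn (normal_vector H \<bullet> x)}"

text \<open>Reversing a normal reverses both signs compared, so the arbitrary orientation of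
  \<open>normal_vector\<close> is harmless.\<close>

definition sep :: "'a::euclidean_space set set \<Rightarrow> 'a \<Rightarrow> 'a \<Rightarrow> 'a set set" where
  "sep B x y = {H\<in>B. sgn (normal_vector H \<bullet> x) \<noteq> sgn (normal_vector H \<bullet> y)}"

lemma central_arrangement_subset:
  "central_arrangement A \<Longrightarrow> B \<subseteq> A \<Longrightarrow> central_arrangement B"
  unfolding central_arrangement_def by (meson finite_subset subset_iff)

lemma normal_vector:
  assumes "central_arrangement B" "H \<in> B"
  shows "normal_vector H \<noteq> 0" "H = {x. normal_vector H \<bullet> x = 0}"
proof -
  have "\<exists>a. a \<noteq> 0 \<and> H = {x. a \<bullet> x = 0}"
    using assms by (auto simp: central_arrangement_def linear_hyperplane_def)
  from someI_ex[OF this] show "normal_vector H \<noteq> 0" "H = {x. normal_vector H \<bullet> x = 0}"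
    unfolding normal_vector_def by blast+
qed

text \<open>Subtracting from \<open>b\<close> its projection onto \<open>a\<close> leaves a vector
  of the common hyperplane, hence orthogonal to \<open>a\<close> and \<open>b\<close>, hence to
  itself.\<close>

lemma hyperplane_normals_parallel:
  fixes a b :: "'a::euclidean_space"
  assumes "a \<noteq> 0" "b \<noteq> 0" "{x. a \<bullet> x = 0} = {x. b \<bullet> x = 0}"
  obtains k where "k \<noteq> 0" "b = k *\<^sub>R a"
proof -
  define k where "k = (a \<bullet> b) / (a \<bullet> a)"
  have 1: "a \<bullet> (b - k *\<^sub>R a) = 0"
    using assms(1) by (simp add: k_def inner_diff_right)
  then have 2: "b \<bullet> (b - k *\<^sub>R a) = 0"
    using assms(3) by blast
  have "(b - k *\<^sub>R a) \<bullet> (b - k *\<^sub>R a) = 0"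
    using 1 2 by (simp add: inner_diff_left)
  then have "b = k *\<^sub>R a"
    by simp
  then show thesis
    using that assms(2) by auto
qed

lemma hyperplanes_eq_if_parallel:
  assumes "central_arrangement B" "H \<in> B" "K \<in> B"
    and "r *\<^sub>R normal_vector H = s *\<^sub>R normal_vector K" "r \<noteq> 0"
  shows "H = K"
proof -
  have *: "r * (normal_vector H \<bullet> x) = s * (normal_vector K \<bullet> x)" for x
    using arg_cong[OF assms(4), of "\<lambda>v. v \<bullet> x"] by simp
  have "s \<noteq> 0"
    using assms normal_vector(1)[OF assms(1,2)] by auto
  then have "normal_vector H \<bullet> x = 0 \<longleftrightarrow> normal_vector K \<bullet> x = 0" for x
    using *[of x] assms(5) by (metis mult_eq_0_iff)
  then show ?thesis
    using normal_vector(2)[OF assms(1,2)] normal_vector(2)[OF assms(1,3)] by auto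
qed

text \<open>Generic points have only two possible signs, so separating sets compose by symmetric
  difference.\<close>

lemma sep_triangle:
  assumes "generic B x" "generic B y" "generic B z" "H \<in> B"
  shows "H \<in> sep B y z \<longleftrightarrow> (H \<in> sep B x y \<longleftrightarrow> H \<notin> sep B x z)"
  using assms by (auto simp: generic_def sep_def sgn_if)

lemma sep_commute: "sep B x y = sep B y x"
  by (auto simp: sep_def)

lemma sep_subset: "sep B x y \<subseteq> B"
  by (auto simp: sep_def)

lemma generic_uminus: "generic B x \<Longrightarrow> generic B (- x)"
  by (simp add: generic_def)

text \<open>Negation reverses every nonzero sign; the antipodal chamber therefore realises the
  complement of a separating set.\<close>

lemma sep_uminus: "generic B x \<Longrightarrow> generic B y \<Longrightarrow> sep B x (- y) = B - sep B x y"
  by (auto simp: sep_def generic_def sgn_if)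

lemma generic_sgn_cong:
  "generic B x \<Longrightarrow> (\<And>H. H \<in> B \<Longrightarrow> sgn (normal_vector H \<bullet> y) = sgn (normal_vector H \<bullet> x))
    \<Longrightarrow> generic B y"
  by (metis generic_def sgn_zero_iff)

lemma generic_subset: "generic A x \<Longrightarrow> B \<subseteq> A \<Longrightarrow> generic B x"
  by (auto simp: generic_def)

subsection \<open>Chambers as sign cells\<close>

lemma generic_iff:
  "central_arrangement B \<Longrightarrow> generic B x \<longleftrightarrow> x \<in> - \<Union>B"
  using normal_vector(2) unfolding generic_def by fastforce

text \<open>A cell is an intersection of convex sets, hence connected. It is maximal because, by the
  intermediate value theorem, a connected set that avoids a hyperplane stays on one side of
  it.\<close>

lemma cell_in_chambers:
  assumes "central_arrangement B" "generic B x"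
  shows "cell B x \<in> chambers B"
proof -
  have "convex (cell B x)"
  proof -
    have "convex {y. sgn (normal_vector H \<bullet> y) = s}" for H :: "'a set" and s
    proof (cases "s = 1 \<or> s = -1 \<or> s = 0")
      case True
      have "{y. sgn (normal_vector H \<bullet> y) = 1} = {y. normal_vector H \<bullet> y > 0}"
        "{y. sgn (normal_vector H \<bullet> y) = -1} = {y. normal_vector H \<bullet> y < 0}"
        "{y. sgn (normal_vector H \<bullet> y) = 0} = {y. normal_vector H \<bullet> y = 0}"
        by (auto simp: sgn_if)
      then show ?thesis
        using True convex_halfspace_gt convex_halfspace_lt convex_hyperplane by metis
    next
      case False
      then have "{y. sgn (normal_vector H \<bullet> y) = s} = {}"
        by (auto simp: sgn_if split: if_splits)
      then show ?thesis by simp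
    qed
    then have "convex (\<Inter>H\<in>B. {y. sgn (normal_vector H \<bullet> y) = sgn (normal_vector H \<bullet> x)})"
      by (intro convex_INT) auto
    moreover have "cell B x = (\<Inter>H\<in>B. {y. sgn (normal_vector H \<bullet> y) = sgn (normal_vector H \<bullet> x)})"
      by (auto simp: cell_def)
    ultimately show ?thesis by simp
  qed
  moreover have "x \<in> cell B x"
    by (simp add: cell_def)
  moreover have "cell B x \<subseteq> - \<Union>B"
    using generic_iff[OF assms(1)] generic_sgn_cong[OF assms(2)] unfolding cell_def by blast
  moreover have "T \<subseteq> cell B x" if T: "connected T" "cell B x \<subseteq> T" "T \<subseteq> - \<Union>B" for T
  proof
    fix y assume "y \<in> T"
    have gT: "generic B z" if "z \<in> T" for z
      using that T(3) generic_iff[OF assms(1)] by blast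
    have "x \<in> T"
      using T(2) \<open>x \<in> cell B x\<close> by blast
    have "sgn (normal_vector H \<bullet> y) = sgn (normal_vector H \<bullet> x)" if "H \<in> B" for H
    proof (rule ccontr)
      assume ne: "\<not> ?thesis"
      have nz: "normal_vector H \<bullet> z \<noteq> 0" if "z \<in> T" for z
        using gT[OF that] \<open>H \<in> B\<close> by (auto simp: generic_def)
      have "\<exists>z\<in>T. normal_vector H \<bullet> z = 0"
      proof (cases "normal_vector H \<bullet> x < 0")
        case True
        then have "normal_vector H \<bullet> y > 0"
          using ne nz[OF \<open>y \<in> T\<close>] by (auto simp: sgn_if split: if_splits)
        then show ?thesis
          using connected_ivt_hyperplane[OF T(1) \<open>x \<in> T\<close> \<open>y \<in> T\<close>, of "normal_vector H" 0] True
          by auto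
      next
        case False
        then have "normal_vector H \<bullet> x > 0" "normal_vector H \<bullet> y < 0"
          using ne nz[OF \<open>y \<in> T\<close>] nz[OF \<open>x \<in> T\<close>] by (auto simp: sgn_if split: if_splits)
        then show ?thesis
          using connected_ivt_hyperplane[OF T(1) \<open>y \<in> T\<close> \<open>x \<in> T\<close>, of "normal_vector H" 0]
          by auto
      qed
      then show False
        using nz by blast
    qed
    then show "y \<in> cell B x"
      by (simp add: cell_def)
  qed
  ultimately show ?thesis
    unfolding chambers_def in_components_maximal
    by (metis convex_connected empty_iff subset_antisym)
qed

lemma mem_cell: "x \<in> cell B x"
  by (simp add: cell_def)

lemma chamber_eq_cell:
  assumes "central_arrangement B" "c \<in> chambers B" "x \<in> c"
  shows "generic B x" "c = cell B x"
proof -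
  show g: "generic B x"
    using assms in_components_subset generic_iff[OF assms(1)] unfolding chambers_def by blast
  show "c = cell B x"
    using components_nonoverlap cell_in_chambers[OF assms(1) g] assms mem_cell[of x B]
    unfolding chambers_def by (metis disjoint_iff)
qed

lemma chamberE:
  assumes "central_arrangement B" "c \<in> chambers B"
  obtains x where "generic B x" "c = cell B x"
proof -
  obtain x where "x \<in> c"
    using assms(2) in_components_nonempty unfolding chambers_def by blast
  then show thesis
    using chamber_eq_cell[OF assms] that by blast
qed

lemma chamber_containing_cell:
  assumes "central_arrangement A" "B \<subseteq> A" "generic A x"
  shows "chamber_containing B (cell A x) = cell B x"
  unfolding chamber_containing_def
proof (rule the1_equality)
  show "\<exists>!d. d \<in> chambers B \<and> cell A x \<subseteq> d"
    using ex1_chamber_containing[OF cell_in_chambers] assms by blast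
  show "cell B x \<in> chambers B \<and> cell A x \<subseteq> cell B x"
    using assms cell_in_chambers[OF central_arrangement_subset[OF assms(1,2)]
        generic_subset[OF assms(3,2)]]
    by (auto simp: cell_def)
qed

lemma separating_set_cell:
  assumes "central_arrangement B" "generic B x" "generic B y"
  shows "separating_set B (cell B x) (cell B y) = sep B x y"
proof -
  have "separates H (cell B x) (cell B y) \<longleftrightarrow> H \<in> sep B x y" if HB: "H \<in> B" for H
  proof
    assume "separates H (cell B x) (cell B y)"
    then obtain a where a: "a \<noteq> 0" "H = {x. a \<bullet> x = 0}" "a \<bullet> x < 0" "a \<bullet> y > 0"
      unfolding separates_def using mem_cell[of x B] mem_cell[of y B] by blast
    obtain k where "k \<noteq> 0" "normal_vector H = k *\<^sub>R a"
    proof (rule hyperplane_normals_parallel)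
      show "{x. a \<bullet> x = 0} = {x. normal_vector H \<bullet> x = 0}"
        using a(2) normal_vector(2)[OF assms(1) HB] by simp
    qed (use a(1) normal_vector(1)[OF assms(1) HB] in auto)
    then show "H \<in> sep B x y"
      using a HB by (auto simp: sep_def sgn_mult sgn_zero_iff)
  next
    assume "H \<in> sep B x y"
    then have s: "sgn (normal_vector H \<bullet> x) \<noteq> sgn (normal_vector H \<bullet> y)"
      by (simp add: sep_def)
    have nz: "normal_vector H \<bullet> x \<noteq> 0" "normal_vector H \<bullet> y \<noteq> 0"
      using assms HB by (auto simp: generic_def)
    \<comment> \<open>The chosen normal, oriented so that it is positive at
      \<open>y\<close>.\<close>
    define a where "a = sgn (normal_vector H \<bullet> y) *\<^sub>R normal_vector H"
    have "a \<noteq> 0" "H = {x. a \<bullet> x = 0}"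
      using nz normal_vector[OF assms(1) HB] by (auto simp: a_def sgn_if)
    moreover have "a \<bullet> z < 0" if "z \<in> cell B x" for z
    proof -
      have "sgn (normal_vector H \<bullet> z) = sgn (normal_vector H \<bullet> x)"
        using that HB by (auto simp: cell_def)
      then show ?thesis
        using s nz by (auto simp: a_def sgn_if split: if_splits)
    qed
    moreover have "a \<bullet> z > 0" if "z \<in> cell B y" for z
    proof -
      have "sgn (normal_vector H \<bullet> z) = sgn (normal_vector H \<bullet> y)"
        using that HB by (auto simp: cell_def)
      then show ?thesis
        using s nz by (auto simp: a_def sgn_if split: if_splits)
    qed
    ultimately show "separates H (cell B x) (cell B y)"
      unfolding separates_def by blast
  qed
  then show ?thesis
    by (auto simp: separating_set_def sep_def)
qed

lemma convex_subset_cell_iff: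
  assumes "central_arrangement B" "generic B x"
  shows "convex_subset B (cell B x) I \<longleftrightarrow>
    (\<forall>H\<in>B - I. \<exists>d. generic B d \<and> H \<in> sep B x d \<and> sep B x d \<subseteq> B - I)"
proof -
  have "(\<exists>c\<in>chambers B. P (separating_set B (cell B x) c)) \<longleftrightarrow>
      (\<exists>d. generic B d \<and> P (sep B x d))" for P
    by (metis assms cell_in_chambers chamberE separating_set_cell)
  from this[of "\<lambda>S. _ \<in> S \<and> S \<subseteq> B - I"] show ?thesis
    unfolding convex_subset_def by (intro ball_cong refl)
qed

subsection \<open>Walls\<close>

text \<open>For small \<open>t\<close> the values that are nonzero at \<open>p\<close> keep their
  sign by continuity, while the others equal \<open>t * (w \<bullet> u)\<close>. Finiteness of
  \<open>W\<close> gives one \<open>t\<close> for all.\<close>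

lemma perturb:
  fixes p u :: "'a::euclidean_space"
  assumes "finite W"
  shows "\<exists>t>0. \<forall>w\<in>W. sgn (w \<bullet> (p + t *\<^sub>R u)) = sgn (if w \<bullet> p = 0 then w \<bullet> u else w \<bullet> p)"
proof -
  have "\<forall>\<^sub>F t in at_right (0::real). sgn (w \<bullet> (p + t *\<^sub>R u)) = sgn (w \<bullet> p)" if "w \<bullet> p \<noteq> 0" for w
  proof -
    have lim: "((\<lambda>t. w \<bullet> (p + t *\<^sub>R u)) \<longlongrightarrow> w \<bullet> (p + 0 *\<^sub>R u)) (at_right 0)"
      by (intro tendsto_intros)
    show ?thesis
    proof (cases "w \<bullet> p > 0")
      case True
      then have "\<forall>\<^sub>F t in at_right 0. w \<bullet> (p + t *\<^sub>R u) > 0"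
        using order_tendstoD(1)[OF lim] by simp
      then show ?thesis
        by (rule eventually_mono) (use True in \<open>simp add: sgn_if\<close>)
    next
      case False
      then have "w \<bullet> p < 0" using that by simp
      then have "\<forall>\<^sub>F t in at_right 0. w \<bullet> (p + t *\<^sub>R u) < 0"
        using order_tendstoD(2)[OF lim] by simp
      then show ?thesis
        by (rule eventually_mono) (use \<open>w \<bullet> p < 0\<close> in \<open>simp add: sgn_if\<close>)
    qed
  qed
  then have "\<forall>\<^sub>F t in at_right (0::real). \<forall>w\<in>W. w \<bullet> p \<noteq> 0 \<longrightarrow>
      sgn (w \<bullet> (p + t *\<^sub>R u)) = sgn (w \<bullet> p)"
    using assms by (simp add: eventually_ball_finite_distrib)
  moreover have "\<forall>\<^sub>F t in at_right (0::real). t > 0"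
    by (simp add: eventually_at_right_less)
  ultimately have "\<forall>\<^sub>F t in at_right (0::real). t > 0 \<and> (\<forall>w\<in>W. w \<bullet> p \<noteq> 0 \<longrightarrow>
      sgn (w \<bullet> (p + t *\<^sub>R u)) = sgn (w \<bullet> p))"
    by (rule eventually_conj[rotated])
  then obtain t where t: "t > 0" "\<forall>w\<in>W. w \<bullet> p \<noteq> 0 \<longrightarrow> sgn (w \<bullet> (p + t *\<^sub>R u)) = sgn (w \<bullet> p)"
    using eventually_happens trivial_limit_at_right_real by blast
  have "sgn (w \<bullet> (p + t *\<^sub>R u)) = sgn (w \<bullet> u)" if "w \<bullet> p = 0" for w
    using that t(1) by (simp add: inner_add_right sgn_mult)
  then show ?thesis
    using t by auto
qed

lemma perturb_normals:
  assumes "central_arrangement B"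
  shows "\<exists>t>0. \<forall>K\<in>B. sgn (normal_vector K \<bullet> (p + t *\<^sub>R u)) =
    sgn (if normal_vector K \<bullet> p = 0 then normal_vector K \<bullet> u else normal_vector K \<bullet> p)"
  using perturb[of "normal_vector ` B" p u] assms by (simp add: central_arrangement_def)

text \<open>Induction on \<open>W\<close>: a small move of \<open>u\<close> along the new vector
  \<open>w\<close> keeps the nonzero products and makes \<open>w \<bullet> u\<close> nonzero if it
  was zero, since \<open>w \<bullet> w > 0\<close>.\<close>

lemma avoid_hyperplanes:
  fixes W :: "'a::euclidean_space set"
  assumes "finite W" "0 \<notin> W"
  shows "\<exists>u. \<forall>w\<in>W. w \<bullet> u \<noteq> 0"
  using assms
proof (induction W)
  case empty
  then show ?case by simp
next
  case (insert w W)
  then obtain u where u: "\<forall>w\<in>W. w \<bullet> u \<noteq> 0"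
    by auto
  obtain t where "\<forall>v\<in>insert w W. sgn (v \<bullet> (u + t *\<^sub>R w)) = sgn (if v \<bullet> u = 0 then v \<bullet> w else v \<bullet> u)"
    using perturb[of "insert w W" u w] insert.hyps by auto
  then have "\<forall>v\<in>insert w W. v \<bullet> (u + t *\<^sub>R w) \<noteq> 0"
    using u insert.prems by (metis inner_eq_zero_iff insert_iff sgn_zero_iff)
  then show ?case by blast
qed

text \<open>Walk from \<open>x\<close> towards a perturbation of \<open>y\<close> that crosses the
  hyperplanes one at a time; \<open>p\<close> is the first crossing point, up to scaling, and
  \<open>z\<close> lies just behind it.\<close>

lemma first_crossing:
  assumes B: "central_arrangement B" and "generic B x" "generic B y" "sep B x y \<noteq> {}"
  obtains H p z where "H \<in> sep B x y" "generic B z" "sep B x z = {H}" "normal_vector H \<bullet> p = 0"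
    "\<forall>K\<in>B - {H}. sgn (normal_vector K \<bullet> p) = sgn (normal_vector K \<bullet> x)"
proof -
  let ?n = "normal_vector :: 'a set \<Rightarrow> 'a"
  have fin: "finite B"
    using B by (simp add: central_arrangement_def)
  have x0: "?n K \<bullet> x \<noteq> 0" "?n K \<bullet> y \<noteq> 0" if "K \<in> B" for K
    using that assms by (auto simp: generic_def)
  \<comment> \<open>A point annihilated by \<open>f (H, K)\<close> is one for which \<open>H\<close>
    and \<open>K\<close> would be crossed simultaneously. These vectors are nonzero because distinct
    hyperplanes have non-parallel normals.\<close>
  define f where "f = (\<lambda>(H, K). (?n H \<bullet> x) *\<^sub>R ?n K - (?n K \<bullet> x) *\<^sub>R ?n H)"
  define V where "V = f ` {(H, K) \<in> B \<times> B. H \<noteq> K}"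
  have "finite {(H, K) \<in> B \<times> B. H \<noteq> K}"
    by (rule finite_subset[of _ "B \<times> B"]) (auto simp: fin)
  then have finV: "finite V"
    unfolding V_def by blast
  have "0 \<notin> V"
  proof
    assume "0 \<in> V"
    then obtain q where q: "0 = f q" "q \<in> {(H, K) \<in> B \<times> B. H \<noteq> K}"
      unfolding V_def by (rule imageE)
    obtain H K where "q = (H, K)"
      by fastforce
    with q have "H \<in> B" "K \<in> B" "H \<noteq> K"
      "(?n H \<bullet> x) *\<^sub>R ?n K = (?n K \<bullet> x) *\<^sub>R ?n H"
      by (simp_all add: f_def)
    then show False
      using hyperplanes_eq_if_parallel[OF B] x0 by metis
  qed
  then obtain u where u: "\<forall>w\<in>V. w \<bullet> u \<noteq> 0"
    using avoid_hyperplanes[OF finV] by blast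
  obtain t where t: "\<forall>v\<in>?n ` B \<union> V.
      sgn (v \<bullet> (y + t *\<^sub>R u)) = sgn (if v \<bullet> y = 0 then v \<bullet> u else v \<bullet> y)"
    using perturb[of "?n ` B \<union> V" y u] fin finV by auto
  \<comment> \<open>\<open>y'\<close> has the signs of \<open>y\<close> on all of \<open>B\<close>,
    but avoids all coincidences of crossings.\<close>
  define y' where "y' = y + t *\<^sub>R u"
  have y': "sgn (?n K \<bullet> y') = sgn (?n K \<bullet> y)" if "K \<in> B" for K
    using t x0(2)[OF that] that by (simp add: y'_def)
  have "v \<bullet> y' \<noteq> 0" if "v \<in> V" for v
  proof -
    have "sgn (v \<bullet> y') \<noteq> 0"
      using t u that by (simp add: y'_def sgn_zero_iff)
    then show ?thesis
      by auto
  qed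
  then have V: "(?n H \<bullet> x) * (?n K \<bullet> y') \<noteq> (?n K \<bullet> x) * (?n H \<bullet> y')"
    if "H \<in> B" "K \<in> B" "H \<noteq> K" for H K
    using that by (force simp: V_def f_def inner_diff_left)
  \<comment> \<open>By homogeneity the walk may run through \<open>s *\<^sub>R x + y'\<close> with
    \<open>s\<close> decreasing to 0. It meets \<open>K\<close> at \<open>s = \<rho> K\<close>, so
    the first hyperplane crossed has the largest \<open>\<rho>\<close>.\<close>
  define \<rho> where "\<rho> K = - (?n K \<bullet> y') / (?n K \<bullet> x)" for K
  have \<rho>: "?n K \<bullet> y' = - \<rho> K * (?n K \<bullet> x)" if "K \<in> B" for K
    using x0[OF that] by (simp add: \<rho>_def)
  have inj: "\<rho> H \<noteq> \<rho> K" if "H \<in> B" "K \<in> B" "H \<noteq> K" for H K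
    using V[OF that] \<rho>[OF that(1)] \<rho>[OF that(2)] by (auto simp: mult_ac)
  have sgn_iff: "K \<in> sep B x y \<longleftrightarrow> \<rho> K > 0" if "K \<in> B" for K
  proof -
    have "sgn (?n K \<bullet> y) = - (sgn (\<rho> K) * sgn (?n K \<bullet> x))"
      using y'[OF that] by (simp add: \<rho>[OF that] sgn_mult)
    then show ?thesis
      using x0[OF that] that by (auto simp: sep_def sgn_if split: if_splits)
  qed
  have "B \<noteq> {}"
    using assms(4) by (auto simp: sep_def)
  then have "Max (\<rho> ` B) \<in> \<rho> ` B"
    using fin by simp
  then obtain H where "H \<in> B" and \<rho>H: "Max (\<rho> ` B) = \<rho> H"
    by (rule imageE)
  then have H: "H \<in> B" "\<And>K. K \<in> B \<Longrightarrow> \<rho> K \<le> \<rho> H"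
    using fin by (simp_all flip: \<rho>H)
  have "\<rho> H > 0"
    using assms(4) sgn_iff H by (force simp: sep_def)
  then have Hs: "H \<in> sep B x y"
    using sgn_iff H(1) by blast
  define p where "p = \<rho> H *\<^sub>R x + y'"
  have p: "?n K \<bullet> p = (\<rho> H - \<rho> K) * (?n K \<bullet> x)" if "K \<in> B" for K
    using \<rho>[OF that] by (simp add: p_def inner_add_right algebra_simps)
  have p0: "?n H \<bullet> p = 0"
    using p[OF H(1)] by simp
  have psgn: "sgn (?n K \<bullet> p) = sgn (?n K \<bullet> x)" if "K \<in> B" "K \<noteq> H" for K
    using p[OF that(1)] H(2)[OF that(1)] inj[OF H(1) that(1)] that(2) by (simp add: sgn_mult)
  obtain t where t: "t > 0" "\<And>K. K \<in> B \<Longrightarrow>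
      sgn (?n K \<bullet> (p + t *\<^sub>R y)) = sgn (if ?n K \<bullet> p = 0 then ?n K \<bullet> y else ?n K \<bullet> p)"
    using perturb_normals[OF B] by blast
  define z where "z = p + t *\<^sub>R y"
  have zH: "sgn (?n H \<bullet> z) = sgn (?n H \<bullet> y)"
    using t(2)[OF H(1)] p0 by (simp add: z_def)
  have zK: "sgn (?n K \<bullet> z) = sgn (?n K \<bullet> x)" if "K \<in> B" "K \<noteq> H" for K
    using t(2)[OF that(1)] psgn[OF that] x0(1)[OF that(1)] by (auto simp: z_def sgn_zero_iff split: if_splits)
  have "generic B z"
    unfolding generic_def
  proof
    fix K assume "K \<in> B"
    then show "?n K \<bullet> z \<noteq> 0"
      using zH zK[of K] x0[of K] by (metis sgn_zero_iff)
  qed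
  moreover have "sep B x z = {H}"
  proof -
    have "K \<in> sep B x z \<longleftrightarrow> K = H" if "K \<in> B" for K
      using Hs zH zK[OF that] that by (cases "K = H") (simp_all add: sep_def)
    then show ?thesis
      using sep_subset[of B x z] H(1) by blast
  qed
  moreover have "\<forall>K\<in>B - {H}. sgn (?n K \<bullet> p) = sgn (?n K \<bullet> x)"
    using psgn by blast
  ultimately show thesis
    using that[OF Hs _ _ p0] by blast
qed

text \<open>All points of \<open>H\<close> near \<open>p\<close> lie in the closure of the cell,
  because adding a small multiple of \<open>x\<close> moves them into the cell. They span
  \<open>H\<close>, so the dimension is full.\<close>

lemma facet_is_wall:
  assumes A: "central_arrangement A" and x: "generic A x" and H: "H \<in> A" "normal_vector H \<bullet> p = 0"
    and sgn: "\<forall>K\<in>A - {H}. sgn (normal_vector K \<bullet> p) = sgn (normal_vector K \<bullet> x)"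
  shows "H \<in> walls A (cell A x)"
proof -
  let ?n = "normal_vector :: 'a set \<Rightarrow> 'a"
  let ?F = "closure (cell A x) \<inter> H"
  have Hn: "?n H \<noteq> 0" "H = {v. ?n H \<bullet> v = 0}"
    using normal_vector[OF A H(1)] .
  have F: "q \<in> ?F" if q: "?n H \<bullet> q = 0"
      "\<And>K. K \<in> A \<Longrightarrow> K \<noteq> H \<Longrightarrow> sgn (?n K \<bullet> q) = sgn (?n K \<bullet> x)" for q
  proof -
    have "q + t *\<^sub>R x \<in> cell A x" if "t > 0" for t
    proof -
      have "sgn (?n K \<bullet> (q + t *\<^sub>R x)) = sgn (?n K \<bullet> x)" if K: "K \<in> A" for K
      proof (cases "K = H")
        case True
        then show ?thesis
          using q(1) \<open>t > 0\<close> by (simp add: inner_add_right sgn_mult)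
      next
        case False
        have "?n K \<bullet> x \<noteq> 0"
          using x K by (simp add: generic_def)
        then show ?thesis
          using q(2)[OF K False] \<open>t > 0\<close>
          by (auto simp: inner_add_right sgn_if add_pos_pos add_neg_neg mult_pos_neg not_less
              split: if_splits) (smt (verit) mult_pos_pos mult_pos_neg)+
      qed
      then show ?thesis
        by (simp add: cell_def)
    qed
    then have "\<And>n. q + (1 / real (Suc n)) *\<^sub>R x \<in> cell A x"
      by simp
    moreover have "(\<lambda>n. q + (1 / real (Suc n)) *\<^sub>R x) \<longlonglongrightarrow> q + 0 *\<^sub>R x"
      by (intro tendsto_intros LIMSEQ_Suc[OF lim_1_over_n])
    ultimately have "q \<in> closure (cell A x)"
      unfolding closure_sequential by (intro exI[of _ "\<lambda>n. q + (1 / real (Suc n)) *\<^sub>R x"]) auto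
    then show ?thesis
      using q(1) Hn(2) by auto
  qed
  have "v \<in> span ?F" if "v \<in> H" for v
  proof -
    have v: "?n H \<bullet> v = 0"
      using that Hn(2) by auto
    obtain t where t: "t > 0" "\<And>K. K \<in> A \<Longrightarrow>
        sgn (?n K \<bullet> (p + t *\<^sub>R v)) = sgn (if ?n K \<bullet> p = 0 then ?n K \<bullet> v else ?n K \<bullet> p)"
      using perturb_normals[OF A] by blast
    have "sgn (?n K \<bullet> (p + t *\<^sub>R v)) = sgn (?n K \<bullet> x)" if "K \<in> A" "K \<noteq> H" for K
    proof -
      have "?n K \<bullet> x \<noteq> 0"
        using x that by (simp add: generic_def)
      then show ?thesis
        using t(2)[OF that(1)] bspec[OF sgn, of K] that by (simp add: sgn_zero_iff split: if_splits)
    qed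
    then have "p + t *\<^sub>R v \<in> ?F"
      using F v H(2) by (simp add: inner_add_right)
    moreover have "p \<in> ?F"
      using F sgn H(2) by blast
    ultimately have "(1 / t) *\<^sub>R ((p + t *\<^sub>R v) - p) \<in> span ?F"
      by (intro span_scale span_diff span_base)
    then show ?thesis
      using t(1) by simp
  qed
  then have "dim H \<le> dim ?F"
    by (metis dim_span dim_subset subsetI)
  moreover have "dim ?F \<le> dim H"
    by (simp add: dim_subset)
  moreover have "dim H = DIM('a) - 1"
    using dim_hyperplane[OF Hn(1)] Hn(2) by simp
  ultimately show ?thesis
    using H(1) by (simp add: walls_def)
qed

text \<open>A closed chamber is cut out by its walls alone. If \<open>K\<close> violated this, the
  first hyperplane crossed from \<open>y\<close> towards a generic point near \<open>q\<close> would
  be a wall on which \<open>q\<close> violates the hypothesis \<open>q\<close>.\<close>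

lemma walls_determine_cell:
  assumes A: "central_arrangement A" and y: "generic A y"
    and q: "\<And>H. H \<in> walls A (cell A y) \<Longrightarrow> normal_vector H \<bullet> q \<noteq> 0 \<Longrightarrow>
      sgn (normal_vector H \<bullet> q) = sgn (normal_vector H \<bullet> y)"
    and K: "K \<in> A" "normal_vector K \<bullet> q \<noteq> 0"
  shows "sgn (normal_vector K \<bullet> q) = sgn (normal_vector K \<bullet> y)"
proof (rule ccontr)
  assume ne: "\<not> ?thesis"
  let ?n = "normal_vector :: 'a set \<Rightarrow> 'a"
  obtain t where t: "t > 0" "\<And>K. K \<in> A \<Longrightarrow>
      sgn (?n K \<bullet> (q + t *\<^sub>R y)) = sgn (if ?n K \<bullet> q = 0 then ?n K \<bullet> y else ?n K \<bullet> q)"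
    using perturb_normals[OF A] by blast
  define r where "r = q + t *\<^sub>R y"
  have "generic A r"
    unfolding generic_def
  proof
    fix L assume "L \<in> A"
    then have "sgn (?n L \<bullet> r) \<noteq> 0"
      using t(2) y by (simp add: r_def generic_def sgn_zero_iff)
    then show "?n L \<bullet> r \<noteq> 0"
      by auto
  qed
  moreover have "K \<in> sep A y r"
    using ne t(2)[OF K(1)] K by (auto simp: sep_def r_def)
  ultimately have "generic A r" "sep A y r \<noteq> {}"
    by auto
  then obtain H p z where H: "H \<in> sep A y r" "generic A z" "sep A y z = {H}" "?n H \<bullet> p = 0"
    "\<forall>K\<in>A - {H}. sgn (?n K \<bullet> p) = sgn (?n K \<bullet> y)"
    by (rule first_crossing[OF A y])
  have "H \<in> A"
    using H(1) by (simp add: sep_def)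
  have "H \<in> walls A (cell A y)"
    by (rule facet_is_wall[OF A y \<open>H \<in> A\<close> H(4,5)])
  then show False
    using H(1) q[of H] t(2)[OF \<open>H \<in> A\<close>] by (auto simp: sep_def r_def split: if_splits)
qed

text \<open>Extend \<open>f\<close> to a linear functional and represent it by a vector, namely its
  adjoint at 1.\<close>

lemma independent_prescribed_inner:
  fixes S :: "'a::euclidean_space set"
  assumes "independent S"
  obtains p where "\<And>w. w \<in> S \<Longrightarrow> w \<bullet> p = f w"
proof -
  obtain g :: "'a \<Rightarrow> real" where g: "linear g" "\<forall>x\<in>S. g x = f x"
    using linear_independent_extend[OF assms, of f] by blast
  have "w \<bullet> adjoint g 1 = g w" for w
    using adjoint_works[OF g(1), of w 1] by (simp add: inner_commute)
  then show thesis
    using that g(2) by metis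
qed

text \<open>Independence of the wall normals allows a point \<open>p\<close> that vanishes on
  \<open>H\<close> and \<open>H'\<close> and lies strictly on the side of \<open>y\<close> for every
  other wall: a relative interior point of the face.\<close>

lemma simplicial_codim2_face:
  assumes A: "central_arrangement A" and "simplicial_arrangement A" and y: "generic A y"
    and W: "H \<in> walls A (cell A y)" "H' \<in> walls A (cell A y)"
  obtains p where "normal_vector H \<bullet> p = 0" "normal_vector H' \<bullet> p = 0"
    "\<And>K. K \<in> A \<Longrightarrow> normal_vector K \<bullet> p \<noteq> 0 \<Longrightarrow> sgn (normal_vector K \<bullet> p) = sgn (normal_vector K \<bullet> y)"
    "\<And>K. K \<in> A \<Longrightarrow> normal_vector K \<bullet> p = 0 \<Longrightarrow> H \<inter> H' \<subseteq> K"
proof -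
  let ?n = "normal_vector :: 'a set \<Rightarrow> 'a"
  let ?W = "walls A (cell A y)"
  have WA: "?W \<subseteq> A"
    by (auto simp: walls_def)
  have "independent (?n ` ?W)"
    using assms(2) cell_in_chambers[OF A y] by (simp add: simplicial_arrangement_def)
  then obtain p where p0: "\<And>w. w \<in> ?n ` ?W \<Longrightarrow>
      w \<bullet> p = (if w = ?n H \<or> w = ?n H' then 0 else sgn (w \<bullet> y))"
    using independent_prescribed_inner
      [of "?n ` ?W" "\<lambda>w. if w = ?n H \<or> w = ?n H' then 0 else sgn (w \<bullet> y)"] by blast
  have p: "?n H \<bullet> p = 0" "?n H' \<bullet> p = 0"
    using p0 W by auto
  have pW: "?n K = ?n H \<or> ?n K = ?n H' \<or> sgn (?n K \<bullet> p) = sgn (?n K \<bullet> y) \<and> ?n K \<bullet> p \<noteq> 0" if "K \<in> ?W" for K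
    using p0[of "?n K"] that WA y by (auto simp: generic_def sgn_zero_iff)
  \<comment> \<open>A displacement inside \<open>H \<inter> H'\<close> that keeps the nonzero signs
    at \<open>p\<close> does not leave the closed chamber.\<close>
  have face: "sgn (?n K \<bullet> (p + v)) = sgn (?n K \<bullet> y)"
    if v: "?n H \<bullet> v = 0" "?n H' \<bullet> v = 0" "\<And>K. K \<in> A \<Longrightarrow> ?n K \<bullet> p \<noteq> 0 \<Longrightarrow> sgn (?n K \<bullet> (p + v)) = sgn (?n K \<bullet> p)"
      and K: "K \<in> A" "?n K \<bullet> (p + v) \<noteq> 0" for K v
  proof (rule walls_determine_cell[OF A y _ K])
    fix L assume L: "L \<in> ?W" "?n L \<bullet> (p + v) \<noteq> 0"
    then have "?n L \<noteq> ?n H" "?n L \<noteq> ?n H'"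
      using p v by (metis add_0 inner_add_right)+
    then show "sgn (?n L \<bullet> (p + v)) = sgn (?n L \<bullet> y)"
      using pW[OF L(1)] v(3)[of L] L(1) WA by auto
  qed
  show thesis
  proof (rule that[OF p])
    show "sgn (?n K \<bullet> p) = sgn (?n K \<bullet> y)" if "K \<in> A" "?n K \<bullet> p \<noteq> 0" for K
      using face[of 0 K] that by simp
    show "H \<inter> H' \<subseteq> K" if K: "K \<in> A" "?n K \<bullet> p = 0" for K
    proof
      fix v assume "v \<in> H \<inter> H'"
      then have v: "?n H \<bullet> v = 0" "?n H' \<bullet> v = 0"
        using normal_vector(2)[OF A] W WA by blast+
      obtain s where s: "s > 0" "\<And>K. K \<in> A \<Longrightarrow>
          sgn (?n K \<bullet> (p + s *\<^sub>R v)) = sgn (if ?n K \<bullet> p = 0 then ?n K \<bullet> v else ?n K \<bullet> p)"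
        using perturb_normals[OF A] by blast
      obtain t where t: "t > 0" "\<And>K. K \<in> A \<Longrightarrow>
          sgn (?n K \<bullet> (p + t *\<^sub>R (- v))) = sgn (if ?n K \<bullet> p = 0 then ?n K \<bullet> (- v) else ?n K \<bullet> p)"
        using perturb_normals[OF A] by blast
      \<comment> \<open>Otherwise \<open>p + s *\<^sub>R v\<close> and
        \<open>p - t *\<^sub>R v\<close>, both in the closed chamber, would lie on opposite sides of
        \<open>K\<close>.\<close>
      have "?n K \<bullet> v = 0"
      proof (rule ccontr)
        assume nz: "?n K \<bullet> v \<noteq> 0"
        have "sgn (?n K \<bullet> (p + s *\<^sub>R v)) = sgn (?n K \<bullet> y)"
          by (rule face) (use v s nz K in \<open>auto simp: inner_add_right\<close>)
        moreover have "sgn (?n K \<bullet> (p + t *\<^sub>R (- v))) = sgn (?n K \<bullet> y)"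
          by (rule face) (use v t nz K in \<open>auto simp: inner_add_right inner_diff_right\<close>)
        ultimately show False
          using K(2) nz s(1) t(1) y K(1)
          by (auto simp: generic_def inner_add_right inner_diff_right sgn_mult sgn_if zero_less_mult_iff mult_less_0_iff split: if_splits)
      qed
      then show "v \<in> K"
        using normal_vector(2)[OF A K(1)] by blast
    qed
  qed
qed

subsection \<open>Rank two\<close>

text \<open>The component of the normal of \<open>K\<close> orthogonal to the span lies in
  \<open>H \<inter> H'\<close>, hence in \<open>K\<close>, which makes it orthogonal to
  itself.\<close>

lemma normal_in_span:
  assumes A: "central_arrangement A" and "H \<in> A" "H' \<in> A" "K \<in> A" "H \<inter> H' \<subseteq> K"
  shows "normal_vector K \<in> span {normal_vector H, normal_vector H'}"
proof -
  let ?n = "normal_vector :: 'a set \<Rightarrow> 'a"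
  obtain v z where v: "v \<in> span {?n H, ?n H'}" and z: "\<And>w. w \<in> span {?n H, ?n H'} \<Longrightarrow> orthogonal z w"
    and vz: "?n K = v + z"
    using orthogonal_subspace_decomp_exists[of "{?n H, ?n H'}" "?n K"] by metis
  have "z \<bullet> ?n H = 0" "z \<bullet> ?n H' = 0"
    using z[of "?n H"] z[of "?n H'"] by (auto simp: span_base orthogonal_def)
  then have "z \<in> H \<inter> H'"
    using normal_vector(2)[OF A] assms(2,3) by (auto simp: inner_commute)
  then have "z \<in> K"
    using assms(5) by blast
  then have "?n K \<bullet> z = 0"
    using normal_vector(2)[OF A assms(4)] by blast
  moreover have "v \<bullet> z = 0"
    using z[OF v] by (simp add: orthogonal_def inner_commute)
  ultimately have "z = 0"
    using vz by (simp add: inner_add_left)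
  then show ?thesis
    using v vz by simp
qed

text \<open>Normalised to have inner product 1 with \<open>x\<close>, the normals lie on an affine line with
  direction \<open>\<delta>\<close>; sets \<open>sep B x d\<close> are initial or final segments of that line according to
  the sign of \<open>\<delta> \<bullet> d\<close>.\<close>

lemma rank2_nested:
  assumes A: "central_arrangement A" and "H \<in> A" "H' \<in> A"
    and B: "B = localization A (H \<inter> H')" and x: "generic B x"
    and d: "generic B d1" "generic B d2" "generic B d3"
  shows "(sep B x d1 \<subseteq> sep B x d2 \<or> sep B x d2 \<subseteq> sep B x d1) \<or>
    (sep B x d1 \<subseteq> sep B x d3 \<or> sep B x d3 \<subseteq> sep B x d1) \<or>
    (sep B x d2 \<subseteq> sep B x d3 \<or> sep B x d3 \<subseteq> sep B x d2)"
proof -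
  let ?n = "normal_vector :: 'a set \<Rightarrow> 'a"
  define w where "w K = (1 / (?n K \<bullet> x)) *\<^sub>R ?n K" for K
  define \<delta> where "\<delta> = w H' - w H"
  have HB: "H \<in> B" "H' \<in> B"
    using assms(2,3) B by (auto simp: localization_def)
  have w1: "w K \<bullet> x = 1" if "K \<in> B" for K
    using x that by (simp add: w_def generic_def)
  have line: "\<exists>b. w K = w H + b *\<^sub>R \<delta>" if "K \<in> B" for K
  proof -
    have "?n K \<in> span {?n H, ?n H'}"
      using normal_in_span[OF A assms(2,3)] that by (auto simp: B localization_def)
    then obtain a c where "?n K - a *\<^sub>R ?n H = c" "c \<in> span {?n H'}"
      by (auto simp: span_breakdown_eq)
    then obtain b where "?n K - a *\<^sub>R ?n H = b *\<^sub>R ?n H'"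
      by (auto simp: span_singleton)
    then have ab: "?n K = a *\<^sub>R ?n H + b *\<^sub>R ?n H'"
      by (simp add: algebra_simps)
    define a' b' where "a' = a * (?n H \<bullet> x) / (?n K \<bullet> x)" and "b' = b * (?n H' \<bullet> x) / (?n K \<bullet> x)"
    have nz: "?n H \<bullet> x \<noteq> 0" "?n H' \<bullet> x \<noteq> 0"
      using x HB by (auto simp: generic_def)
    have wK: "w K = a' *\<^sub>R w H + b' *\<^sub>R w H'"
      unfolding w_def a'_def b'_def using nz by (subst (2) ab) (simp add: scaleR_add_right)
    have "a' + b' = 1"
      using w1[OF that] w1[OF HB(1)] w1[OF HB(2)] by (simp add: wK inner_add_left)
    then have a': "a' = 1 - b'"
      by simp
    show ?thesis
      unfolding wK \<delta>_def a' by (intro exI[of _ b']) (simp add: algebra_simps)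
  qed
  have sep: "K \<in> sep B x d \<longleftrightarrow> w K \<bullet> d < 0" if "K \<in> B" "generic B d" for K d
    using that x by (auto simp: sep_def w_def generic_def sgn_if divide_simps split: if_splits)
  \<comment> \<open>Witnesses \<open>K\<close> and \<open>L\<close> against both inclusions would
    force \<open>\<delta> \<bullet> d\<close> and \<open>\<delta> \<bullet> e\<close> to have
    strictly opposite signs.\<close>
  have nested: "sep B x d \<subseteq> sep B x e \<or> sep B x e \<subseteq> sep B x d"
    if "generic B d" "generic B e" "0 \<le> (\<delta> \<bullet> d) * (\<delta> \<bullet> e)" for d e
  proof (rule ccontr)
    assume "\<not> ?thesis"
    then obtain K L where KL: "K \<in> sep B x d" "K \<notin> sep B x e" "L \<in> sep B x e" "L \<notin> sep B x d"
      by blast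
    then have KLB: "K \<in> B" "L \<in> B"
      by (auto simp: sep_def)
    obtain b b' where b: "w K = w H + b *\<^sub>R \<delta>" "w L = w H + b' *\<^sub>R \<delta>"
      using line KLB by metis
    have "w K \<bullet> d < w L \<bullet> d" "w L \<bullet> e < w K \<bullet> e"
      using KL sep KLB that by (meson less_le_trans not_less)+
    then have "(b - b') * (\<delta> \<bullet> d) < 0" "(b - b') * (\<delta> \<bullet> e) > 0"
      by (simp_all add: b inner_add_left algebra_simps)
    then have "(b - b') * (\<delta> \<bullet> d) * ((b - b') * (\<delta> \<bullet> e)) < 0"
      by (rule mult_neg_pos)
    then have "(b - b')\<^sup>2 * ((\<delta> \<bullet> d) * (\<delta> \<bullet> e)) < 0"
      by (simp add: power2_eq_square algebra_simps)
    then show False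
      using that(3) by (smt (verit) mult_nonneg_nonneg zero_le_power2)
  qed
  \<comment> \<open>Among three reals, two have a nonnegative product.\<close>
  have "0 \<le> (\<delta> \<bullet> d1) * (\<delta> \<bullet> d2) \<or> 0 \<le> (\<delta> \<bullet> d1) * (\<delta> \<bullet> d3) \<or> 0 \<le> (\<delta> \<bullet> d2) * (\<delta> \<bullet> d3)"
    by (metis mult_nonneg_nonneg mult_nonpos_nonpos linear)
  then show ?thesis
    using nested d by metis
qed


text \<open>If \<open>I\<close> is neither empty nor full on \<open>B\<close>, a largest nonempty
  separating set inside \<open>I\<close> is all of \<open>I \<inter> B\<close>: a nonempty one
  inside the complement is nested with none inside \<open>I\<close>, so those inside
  \<open>I\<close> form a chain.\<close>

lemma rank2_biclosed:
  assumes A: "central_arrangement A" and H: "H \<in> A" "H' \<in> A"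
    and B: "B = localization A (H \<inter> H')" and x: "generic B x"
    and co: "\<forall>K\<in>B - I. \<exists>d. generic B d \<and> K \<in> sep B x d \<and> sep B x d \<subseteq> B - I"
    and cl: "\<forall>K\<in>I \<inter> B. \<exists>d. generic B d \<and> K \<in> sep B x d \<and> sep B x d \<subseteq> I \<inter> B"
  shows "\<exists>e. generic B e \<and> I \<inter> B = sep B x e"
proof -
  have fin: "finite B"
    using A by (simp add: B localization_def central_arrangement_def)
  have self: "sep B x x = {}"
    by (simp add: sep_def)
  consider "I \<inter> B = {}" | "B - I = {}" | "I \<inter> B \<noteq> {}" "B - I \<noteq> {}"
    by blast
  then show ?thesis
  proof cases
    case 1
    then show ?thesis
      using x self by blast
  next
    case 2
    then have "I \<inter> B = sep B x (- x)"
      using sep_uminus[OF x x] self by blast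
    then show ?thesis
      using generic_uminus[OF x] by blast
  next
    case 3
    define P where "P d \<longleftrightarrow> generic B d \<and> sep B x d \<noteq> {} \<and> sep B x d \<subseteq> I \<inter> B" for d
    obtain d0 where "P d0"
      using 3(1) cl unfolding P_def by blast
    \<comment> \<open>The greatest-element rule needs a strict bound, hence the successor.\<close>
    moreover have "\<forall>d. P d \<longrightarrow> card (sep B x d) < Suc (card B)"
      using fin by (auto simp: sep_def less_Suc_eq_le intro: card_mono)
    ultimately obtain d where d: "P d" "\<And>e. P e \<Longrightarrow> card (sep B x e) \<le> card (sep B x d)"
      using ex_has_greatest_nat[of P d0 "\<lambda>d. card (sep B x d)" "Suc (card B)"] by blast
    obtain d3 where d3: "generic B d3" "sep B x d3 \<noteq> {}" "sep B x d3 \<subseteq> B - I"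
      using 3(2) co by blast
    have "K \<in> sep B x d" if K: "K \<in> I \<inter> B" for K
    proof (rule ccontr)
      assume nK: "K \<notin> sep B x d"
      obtain d2 where d2: "generic B d2" "K \<in> sep B x d2" "sep B x d2 \<subseteq> I \<inter> B"
        using cl K by blast
      have "sep B x d \<subseteq> sep B x d2"
        using rank2_nested[OF A H B x _ d2(1) d3(1), of d] d(1) d2 d3 nK unfolding P_def by blast
      then have "sep B x d \<subset> sep B x d2"
        using d2(2) nK by blast
      then have "card (sep B x d) < card (sep B x d2)"
        using fin by (intro psubset_card_mono) (auto simp: sep_def)
      moreover have "P d2"
        using d2 unfolding P_def by blast
      ultimately show False
        using d(2)[of d2] by simp
    qed
    then have "I \<inter> B = sep B x d"
      using d(1) unfolding P_def by blast
    then show ?thesis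
      using d(1) unfolding P_def by blast
  qed
qed

text \<open>The intersection is the orthogonal complement of the span of two independent
  normals.\<close>

lemma dim_hyperplane_Int:
  fixes H H' :: "'a::euclidean_space set"
  assumes A: "central_arrangement A" and "H \<in> A" "H' \<in> A" "H \<noteq> H'"
  shows "dim (H \<inter> H') + 2 = DIM('a)"
proof -
  let ?S = "{normal_vector H, normal_vector H'}"
  have nz: "normal_vector H \<noteq> 0" "normal_vector H' \<noteq> 0"
    using normal_vector(1)[OF A] assms by auto
  have ne: "normal_vector H \<noteq> normal_vector H'"
    using normal_vector(2)[OF A] assms by metis
  have "normal_vector H \<notin> span {normal_vector H'}"
    using hyperplanes_eq_if_parallel[OF A assms(2,3), of 1] assms(4)
    by (auto simp: span_singleton)
  then have "independent ?S"
    using nz ne by (simp add: independent_insert)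
  then have "dim (span ?S) = 2"
    using ne by (simp add: dim_eq_card_independent)
  moreover have "H \<inter> H' = {y \<in> UNIV. \<forall>x\<in>span ?S. orthogonal x y}"
  proof -
    have "H \<inter> H' = {y. \<forall>x\<in>?S. orthogonal x y}"
      using normal_vector(2)[OF A] assms(2,3) unfolding orthogonal_def by auto
    also have "\<dots> = {y. \<forall>x\<in>span ?S. orthogonal x y}"
    proof (intro Collect_cong iffI ballI)
      show "orthogonal x y" if "\<forall>x\<in>?S. orthogonal x y" "x \<in> span ?S" for x y
        using orthogonal_to_span[OF that(2), of y] that(1) by (simp add: orthogonal_commute)
    qed (simp add: span_base)
    finally show ?thesis
      by simp
  qed
  moreover have "dim {y \<in> UNIV. \<forall>x\<in>span ?S. orthogonal x y} + dim (span ?S) = dim (UNIV :: 'a set)"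
    by (rule dim_subspace_orthogonal_to_vectors) auto
  ultimately show ?thesis
    by (simp add: dim_UNIV)
qed

subsection \<open>Local to global\<close>

text \<open>The hypothesis \<open>loc\<close> supplies a local target \<open>e\<close>; the first
  wall from \<open>x\<close> towards it yields the shortcut that contradicts the choice of
  \<open>y\<close>.\<close>

lemma locally_separating_imp_separating:
  assumes A: "central_arrangement A" and simp: "simplicial_arrangement A" and x0: "generic A x0"
    and IA: "I \<subseteq> A"
    and loc: "\<And>H H'. H \<in> A \<Longrightarrow> H' \<in> A \<Longrightarrow> H \<noteq> H' \<Longrightarrow>
      \<exists>e. generic (localization A (H \<inter> H')) e \<and>
        I \<inter> localization A (H \<inter> H') = sep (localization A (H \<inter> H')) x0 e"
  shows "\<exists>x. generic A x \<and> I = sep A x0 x"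
proof -
  let ?n = "normal_vector :: 'a set \<Rightarrow> 'a"
  have finA: "finite A"
    using A by (simp add: central_arrangement_def)
  have fin: "finite (sep A v w)" for v w
    using finA by (simp add: sep_def)
  \<comment> \<open>The hyperplanes on which \<open>I\<close> and the separating set of
    \<open>x\<close> disagree.\<close>
  define J where "J x = {K \<in> A. (K \<in> I) \<noteq> (K \<in> sep A x0 x)}" for x
  obtain x where x: "generic A x" and xmin: "\<And>y. generic A y \<Longrightarrow> card (J x) \<le> card (J y)"
    using ex_has_least_nat[of "generic A" x0 "\<lambda>x. card (J x)"] x0 by blast
  have finJ: "finite (J x)"
    using finA by (simp add: J_def)
  have "J x = {}"
  proof (rule ccontr)
    assume Jx: "J x \<noteq> {}"
    define P where "P y \<longleftrightarrow> generic A y \<and> sep A x y \<inter> J x \<noteq> {}" for y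
    have "sep A x (- x) = A"
      using sep_uminus[OF x x] by (simp add: sep_def)
    then have "P (- x)"
      using Jx generic_uminus[OF x] by (auto simp: P_def J_def)
    then obtain y where y: "P y" and ymin: "\<And>z. P z \<Longrightarrow> card (sep A x y) \<le> card (sep A x z)"
      using ex_has_least_nat[of P "- x" "\<lambda>z. card (sep A x z)"] by blast
    have gy: "generic A y" and "sep A y x \<noteq> {}"
      using y sep_commute[of A x y] by (auto simp: P_def)
    from first_crossing[OF A gy x this(2)] obtain H p y' where
      H: "H \<in> sep A y x" "generic A y'" "sep A y y' = {H}" "?n H \<bullet> p = 0"
      "\<forall>K\<in>A - {H}. sgn (?n K \<bullet> p) = sgn (?n K \<bullet> y)"
      by metis
    have HA: "H \<in> A" and Hxy: "H \<in> sep A x y"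
      using H(1) sep_commute[of A x y] by (auto simp: sep_def)
    have "K \<in> sep A x y' \<longleftrightarrow> K \<in> sep A x y - {H}" if "K \<in> A" for K
      using sep_triangle[OF gy x H(2) that] H(1,3) sep_commute[of A x y] by auto
    then have sxy': "sep A x y' = sep A x y - {H}"
      unfolding sep_def by blast
    have card: "card (sep A x y') < card (sep A x y)"
      unfolding sxy' using fin Hxy by (intro psubset_card_mono) auto
    \<comment> \<open>Minimality of \<open>y\<close> applies to the closer \<open>y'\<close>, so
      \<open>H\<close> is the only disagreement separating \<open>x\<close> from
      \<open>y\<close>.\<close>
    then have disj: "sep A x y' \<inter> J x = {}"
      using ymin[of y'] H(2) by (auto simp: P_def)
    then have HJ: "H \<in> J x"
      using y sxy' by (auto simp: P_def)
    \<comment> \<open>If \<open>H\<close> alone separated \<open>x\<close> from \<open>y\<close>,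
      moving to \<open>y\<close> would remove it from \<open>J x\<close>, against minimality of
      \<open>x\<close>.\<close>
    have "sep A y' x \<noteq> {}"
    proof
      assume "sep A y' x = {}"
      then have sxy: "sep A x y = {H}"
        using sxy' Hxy sep_commute[of A x y'] by auto
      have "K \<in> sep A x0 y \<longleftrightarrow> (K \<in> sep A x0 x \<longleftrightarrow> K \<noteq> H)" if "K \<in> A" for K
        using sep_triangle[OF x x0 gy that] sxy sep_commute[of A x x0] by auto
      then have "J y = J x - {H}"
        using HJ by (auto simp: J_def)
      then have "card (J y) < card (J x)"
        using HJ finJ by (metis card_Diff1_less)
      then show False
        using xmin[OF gy] by simp
    qed
    from first_crossing[OF A H(2) x this] obtain H' p' where
      H': "H' \<in> sep A y' x" "?n H' \<bullet> p' = 0"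
      "\<forall>K\<in>A - {H'}. sgn (?n K \<bullet> p') = sgn (?n K \<bullet> y')"
      by metis
    have H'A: "H' \<in> A" and H'xy': "H' \<in> sep A x y'"
      using H'(1) sep_commute[of A x y'] by (auto simp: sep_def)
    then have "H \<noteq> H'"
      using sxy' by blast
    \<comment> \<open>The facet point \<open>p\<close> found from \<open>y\<close> also serves
      \<open>y'\<close>, as only \<open>H\<close> separates the two.\<close>
    have "sgn (?n K \<bullet> p) = sgn (?n K \<bullet> y')" if "K \<in> A - {H}" for K
    proof -
      have "K \<notin> sep A y y'"
        using H(3) that by blast
      then show ?thesis
        using H(5) that by (auto simp: sep_def)
    qed
    then have "H \<in> walls A (cell A y')"
      using facet_is_wall[OF A H(2) HA H(4)] by blast
    moreover have "H' \<in> walls A (cell A y')"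
      by (rule facet_is_wall[OF A H(2) H'A H'(2,3)])
    ultimately obtain q where q: "?n H \<bullet> q = 0" "?n H' \<bullet> q = 0"
      and qsgn: "\<And>K. K \<in> A \<Longrightarrow> ?n K \<bullet> q \<noteq> 0 \<Longrightarrow> sgn (?n K \<bullet> q) = sgn (?n K \<bullet> y')"
      and qsub: "\<And>K. K \<in> A \<Longrightarrow> ?n K \<bullet> q = 0 \<Longrightarrow> H \<inter> H' \<subseteq> K"
      using simplicial_codim2_face[OF A simp H(2), of H H'] by metis
    define B where "B = localization A (H \<inter> H')"
    have BA: "B \<subseteq> A" and HB: "H \<in> B" "H' \<in> B"
      using HA H'A by (auto simp: B_def localization_def)
    have B_iff: "K \<in> B \<longleftrightarrow> ?n K \<bullet> q = 0" if "K \<in> A" for K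
    proof
      have "q \<in> H \<inter> H'"
        using q normal_vector(2)[OF A HA] normal_vector(2)[OF A H'A] by auto
      then show "?n K \<bullet> q = 0" if "K \<in> B"
        using that normal_vector(2)[OF A \<open>K \<in> A\<close>] by (auto simp: B_def localization_def)
      show "K \<in> B" if "?n K \<bullet> q = 0"
        using that qsub \<open>K \<in> A\<close> by (simp add: B_def localization_def)
    qed
    have B: "central_arrangement B"
      by (rule central_arrangement_subset[OF A BA])
    have gB: "generic B x0" "generic B x"
      using generic_subset BA x x0 by blast+
    obtain e where e: "generic B e" "I \<inter> B = sep B x0 e"
      using loc[OF HA H'A \<open>H \<noteq> H'\<close>] unfolding B_def by blast
    \<comment> \<open>On \<open>B\<close> the set \<open>I\<close> is realised by \<open>e\<close>,
      so disagreeing with \<open>I\<close> means separating \<open>x\<close> from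
      \<open>e\<close>.\<close>
    have eJ: "K \<in> sep B x e \<longleftrightarrow> K \<in> J x" if "K \<in> B" for K
      using sep_triangle[OF gB(1,2) e(1) that] that BA e(2)[symmetric]
      by (auto simp: J_def sep_def)
    then have "sep B x e \<noteq> {}"
      using HB HJ by blast
    from first_crossing[OF B gB(2) e(1) this] obtain K0 u where
      u: "K0 \<in> sep B x e" "generic B u" "sep B x u = {K0}"
      by metis
    have K0: "K0 \<in> B" "K0 \<in> J x"
      using u(1) eJ by (auto simp: sep_def)
    obtain t where t: "t > 0" "\<And>K. K \<in> A \<Longrightarrow>
        sgn (?n K \<bullet> (q + t *\<^sub>R u)) = sgn (if ?n K \<bullet> q = 0 then ?n K \<bullet> u else ?n K \<bullet> q)"
      using perturb_normals[OF A] by blast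
    \<comment> \<open>A point near the face point \<open>q\<close>: it has the signs of
      \<open>u\<close> on \<open>B\<close>, and those of \<open>y'\<close> elsewhere.\<close>
    define z where "z = q + t *\<^sub>R u"
    have z: "sgn (?n K \<bullet> z) = sgn (?n K \<bullet> (if K \<in> B then u else y'))" if "K \<in> A" for K
      using t(2)[OF that] B_iff[OF that] qsgn[OF that] by (simp add: z_def)
    have "generic A z"
      unfolding generic_def
    proof
      fix K assume K: "K \<in> A"
      then have "?n K \<bullet> (if K \<in> B then u else y') \<noteq> 0"
        using u(2) H(2) by (simp add: generic_def)
      then show "?n K \<bullet> z \<noteq> 0"
        using z[OF K] by (metis sgn_zero_iff)
    qed
    have "K \<in> sep A x z \<longleftrightarrow> (if K \<in> B then K \<in> sep B x u else K \<in> sep A x y')" if "K \<in> A" for K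
      using z[OF that] that by (auto simp: sep_def)
    then have sxz: "sep A x z = insert K0 (sep A x y' - B)"
      using u(3) K0(1) BA sep_subset[of A x z] sep_subset[of A x y']
      by (auto split: if_splits)
    have "P z"
      using \<open>generic A z\<close> K0(2) by (auto simp: P_def sxz)
    then have "card (sep A x y) \<le> card (sep A x z)"
      by (rule ymin)
    \<comment> \<open>Compared with \<open>y'\<close>, the point \<open>z\<close> gains at most
      \<open>K0\<close> but loses \<open>H'\<close>, which lies in \<open>B\<close>; so it is closer
      to \<open>x\<close> than \<open>y\<close>.\<close>
    also have "\<dots> \<le> card (insert K0 (sep A x y' - {H'}))"
      using fin HB(2) by (intro card_mono) (auto simp: sxz)
    also have "\<dots> \<le> Suc (card (sep A x y' - {H'}))"
      using fin by (simp add: card_insert_if)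
    also have "\<dots> = card (sep A x y')"
      by (rule card_Suc_Diff1[OF fin H'xy'])
    finally show False
      using card by simp
  qed
  then have "I = sep A x0 x"
    using IA by (auto simp: J_def sep_def)
  then show ?thesis
    using x by blast
qed

text \<open>The chamber of a localization around the cell of \<open>x\<close> is again the sign cell
  of \<open>x\<close>, so a single base point serves every \<open>X\<close>.\<close>

lemma two_closed_cell_iff:
  assumes A: "central_arrangement A" and x: "generic A x" and IA: "I \<subseteq> A"
  shows "two_closed A (cell A x) I \<longleftrightarrow>
    (\<forall>X\<in>intersection_subspaces A. dim X + 2 = DIM('a::euclidean_space) \<longrightarrow>
      (\<forall>H\<in>localization A X - I. \<exists>d. generic (localization A X) d \<and>
        H \<in> sep (localization A X) (x :: 'a) d \<and> sep (localization A X) x d \<subseteq> localization A X - I))"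
proof -
  have "convex_subset (localization A X) (chamber_containing (localization A X) (cell A x))
      (I \<inter> localization A X) \<longleftrightarrow>
      (\<forall>H\<in>localization A X - I. \<exists>d. generic (localization A X) d \<and>
        H \<in> sep (localization A X) x d \<and> sep (localization A X) x d \<subseteq> localization A X - I)" for X
  proof -
    have BA: "localization A X \<subseteq> A"
      by (auto simp: localization_def)
    have "localization A X - I \<inter> localization A X = localization A X - I"
      by blast
    then show ?thesis
      using chamber_containing_cell[OF A BA x] generic_subset[OF x BA]
        convex_subset_cell_iff[OF central_arrangement_subset[OF A BA]] by simp
  qed
  then show ?thesis
    by (simp add: two_closed_def)
qed

theorem theorem5p4:
  fixes A I :: "(real ^ 'n) set set" and c0 :: "(real ^ 'n) set"
  assumes "central_arrangement A"
    and "simplicial_arrangement A"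
    and "c0 \<in> chambers A"
    and "I \<subseteq> A"
  shows "biclosed A c0 I \<longleftrightarrow> (\<exists>c\<in>chambers A. I = separating_set A c0 c)"
proof -
  note A = assms(1)
  obtain x0 where x0: "generic A x0" and c0: "c0 = cell A x0"
    using chamberE[OF A assms(3)] by blast
  have "(\<exists>c\<in>chambers A. I = separating_set A c0 c) \<longleftrightarrow> (\<exists>x. generic A x \<and> I = sep A x0 x)"
    unfolding c0 by (metis A x0 cell_in_chambers chamberE separating_set_cell)
  also have "\<dots> \<longleftrightarrow> biclosed A c0 I"
  proof
    assume "biclosed A c0 I"
    then have cl: "two_closed A (cell A x0) I" "two_closed A (cell A x0) (A - I)"
      by (simp_all add: biclosed_def c0)
    show "\<exists>x. generic A x \<and> I = sep A x0 x"
    proof (rule locally_separating_imp_separating[OF A assms(2) x0 assms(4)])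
      fix H H' assume H: "H \<in> A" "H' \<in> A" "H \<noteq> H'"
      let ?B = "localization A (H \<inter> H')"
      have BA: "?B \<subseteq> A"
        by (auto simp: localization_def)
      have X: "H \<inter> H' \<in> intersection_subspaces A"
        unfolding intersection_subspaces_def using H by (auto intro: exI[of _ "{H, H'}"])
      \<comment> \<open>Turns closedness of the complement into the second closure hypothesis of
        \<open>rank2_biclosed\<close>.\<close>
      have "?B - (A - I) = I \<inter> ?B"
        using BA by blast
      then show "\<exists>e. generic ?B e \<and> I \<inter> ?B = sep ?B x0 e"
        using rank2_biclosed[OF A H(1,2) refl generic_subset[OF x0 BA], of I]
          cl[unfolded two_closed_cell_iff[OF A x0 assms(4)] two_closed_cell_iff[OF A x0 Diff_subset]]
          X dim_hyperplane_Int[OF A H] by auto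
    qed
  next
    assume "\<exists>x. generic A x \<and> I = sep A x0 x"
    then obtain x where x: "generic A x" and I: "I = sep A x0 x"
      by blast
    \<comment> \<open>The antipode \<open>- x\<close> is a witness for every \<open>X\<close> and
      \<open>H\<close>; for the complement of \<open>I\<close> the point \<open>x\<close> itself
      is.\<close>
    have "\<exists>d. generic (localization A X) d \<and> H \<in> sep (localization A X) x0 d \<and>
        sep (localization A X) x0 d \<subseteq> localization A X - I" if "H \<in> localization A X - I" for H X
    proof (intro exI conjI)
      have BA: "localization A X \<subseteq> A"
        by (auto simp: localization_def)
      then have g: "generic (localization A X) x0" "generic (localization A X) x"
        using x x0 generic_subset by blast+
      have "sep (localization A X) x0 x = I \<inter> localization A X"
        using BA by (auto simp: I sep_def)
      then show "H \<in> sep (localization A X) x0 (- x)"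
        "sep (localization A X) x0 (- x) \<subseteq> localization A X - I"
        using that by (auto simp: sep_uminus[OF g])
      show "generic (localization A X) (- x)"
        by (rule generic_uminus[OF g(2)])
    qed
    moreover have "\<exists>d. generic (localization A X) d \<and> H \<in> sep (localization A X) x0 d \<and>
        sep (localization A X) x0 d \<subseteq> localization A X - (A - I)"
      if "H \<in> localization A X - (A - I)" for H X
      using that generic_subset[OF x, of "localization A X"]
      by (intro exI[of _ x]) (auto simp: I sep_def localization_def)
    ultimately show "biclosed A c0 I"
      unfolding biclosed_def c0 two_closed_cell_iff[OF A x0 assms(4)]
        two_closed_cell_iff[OF A x0 Diff_subset] by blast
  qed
  finally show ?thesis
    by blast
qed

end
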